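(* Let $\mathcal M$ and $\mathcal N=\{N^{(\lambda)}:\lambda\in\mathbb R_{>0}\}$ be two quasianalytic weight matrices and assume $\sup_{k\in\mathbb N_{>0}}(n^{(\lambda)}_k)^{1/k}=+\infty$ for all $\lambda>0$. Then $\Lambda^r_{\{\mathcal N\}}\setminus j^\infty(\mathcal E^{0,r}_{\{\mathcal M\}})$ is dense in $\Lambda^r_{\{\mathcal N\}}$.
   Context: For a sequence $M=(M_p)_{p\in\mathbb N}$ of positive reals write $m_p:=M_p/p!$. $M$ is a weight sequence if $1=M_0\le M_1$, $M_p^2\le M_{p-1}M_{p+1}$ for all $p\ge1$, and $\liminf_{p\to\infty}m_p^{1/p}>0$; it is quasianalytic if $\sum_{p\ge1}M_{p-1}/M_p=+\infty$. A weight matrix is a family $\mathcal M=\{M^{(\lambda)}:\lambda\in\mathbb R_{>0}\}$ of weight sequences with $M^{(\lambda)}_p\le M^{(\kappa)}_p$ for all $p$ whenever $\lambda\le\kappa$; write $n^{(\lambda)}_p:=N^{(\lambda)}_p/p!$. It is quasianalytic if every member is quasianalytic. For $U\subseteq\mathbb R^r$ open, $K\subseteq U$ compact, $h>0$: $\|f\|^M_{K,h}:=\sup_{\alpha\in\mathbb N^r,x\in K}|\partial^\alpha f(x)|/(h^{|\alpha|}M_{|\alpha|})$. $\mathcal E_{\{\mathcal M\}}(U)$: smooth $f$ such that for every compact $K\subseteq U$ there exist $\lambda>0$, $h>0$ with $\|f\|^{M^{(\lambda)}}_{K,h}<\infty$; $\mathcal E^{0,r}_{\{\mathcal M\}}$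 is the space of germs at $0\in\mathbb R^r$ of functions in $\mathcal E_{\{\mathcal M\}}((-1/k,1/k)^r)$ for some $k$. For $\mathbf b=(b_\alpha)_{\alpha\in\mathbb N^r}$, a weight sequence $N$, $h>0$: $|\mathbf b|^N_h:=\sup_\alpha|b_\alpha|/(h^{|\alpha|}n_{|\alpha|})$; $\Lambda^r_{\{\mathcal N\}}:=\{\mathbf b:\exists\lambda>0\,\exists h>0,\ |\mathbf b|^{N^{(\lambda)}}_h<\infty\}$, endowed with the inductive limit topology of the Banach spaces $\{\mathbf b:|\mathbf b|^{N^{(n)}}_n<\infty\}$, $n\in\mathbb N_{>0}$. The Borel map is $j^\infty(f)=(\partial^\alpha f(0)/|\alpha|!)_{\alpha\in\mathbb N^r}$. *)

theory Defs
  imports "HOL-Analysis.Analysis" "HOL-Library.Liminf_Limsup"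
begin

definition weight_seq :: "(nat \<Rightarrow> real) \<Rightarrow> bool" where
  "weight_seq M \<longleftrightarrow>
     (\<forall>p. M p > 0) \<and> M 0 = 1 \<and> M 0 \<le> M 1 \<and>
     (\<forall>p\<ge>1. (M p)^2 \<le> M (p - 1) * M (p + 1)) \<and>
     liminf (\<lambda>p. ereal (root p (M p / fact p))) > 0"

definition quasianalytic_seq :: "(nat \<Rightarrow> real) \<Rightarrow> bool" where
  "quasianalytic_seq M \<longleftrightarrow> \<not> summable (\<lambda>p. M p / M (Suc p))"
  \<comment> \<open>\<open>\<Sum>_{p\<ge>1} M_{p-1}/M_p = +\<infinity>\<close>; the terms are positive\<close>

definition weight_matrix :: "(real \<Rightarrow> nat \<Rightarrow> real) \<Rightarrow> bool" where
  "weight_matrix MM \<longleftrightarrow>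
     (\<forall>l>0. weight_seq (MM l)) \<and>
     (\<forall>l \<kappa> p. 0 < l \<longrightarrow> l \<le> \<kappa> \<longrightarrow> MM l p \<le> MM \<kappa> p)"

definition quasianalytic_matrix :: "(real \<Rightarrow> nat \<Rightarrow> real) \<Rightarrow> bool" where
  "quasianalytic_matrix MM \<longleftrightarrow> (\<forall>l>0. quasianalytic_seq (MM l))"

text \<open>\<open>\<real>^r\<close> is \<open>real^'n\<close> with \<open>r = CARD('n)\<close>; multi-indices are \<open>'n \<Rightarrow> nat\<close>.\<close>

definition pderiv1 :: "'n::finite \<Rightarrow> (real^'n \<Rightarrow> real) \<Rightarrow> real^'n \<Rightarrow> real" where
  "pderiv1 i f x = frechet_derivative f (at x) (axis i 1)"

fun Ck_on :: "nat \<Rightarrow> (real^'n::finite) set \<Rightarrow> (real^'n \<Rightarrow> real) \<Rightarrow> bool" where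
  "Ck_on 0 U f \<longleftrightarrow> continuous_on U f"
| "Ck_on (Suc k) U f \<longleftrightarrow> f differentiable_on U \<and> (\<forall>i. Ck_on k U (pderiv1 i f))"

definition smooth_on :: "(real^'n::finite) set \<Rightarrow> (real^'n \<Rightarrow> real) \<Rightarrow> bool" where
  "smooth_on U f \<longleftrightarrow> (\<forall>k. Ck_on k U f)"

definition mi_abs :: "('n::finite \<Rightarrow> nat) \<Rightarrow> nat" where
  "mi_abs \<alpha> = (\<Sum>i\<in>UNIV. \<alpha> i)"

text \<open>\<open>\<partial>^\<alpha> f\<close> (for smooth \<open>f\<close> the order of differentiation is irrelevant).\<close>
definition pderiv_mi :: "('n::{finite,enum} \<Rightarrow> nat) \<Rightarrow> ((real,'n) vec \<Rightarrow> real) \<Rightarrow> (real,'n) vec \<Rightarrow> real" where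
  "pderiv_mi \<alpha> f = foldr (\<lambda>i g. (pderiv1 i ^^ \<alpha> i) g) Enum.enum f"

definition E_roumieu :: "(real \<Rightarrow> nat \<Rightarrow> real) \<Rightarrow> ((real,'n::{finite,enum}) vec) set \<Rightarrow> ((real,'n) vec \<Rightarrow> real) set" where
  "E_roumieu MM U = {f. smooth_on U f \<and>
     (\<forall>K. compact K \<and> K \<subseteq> U \<longrightarrow>
        (\<exists>l>0. \<exists>h>0. \<exists>C. \<forall>\<alpha>. \<forall>x\<in>K.
            \<bar>pderiv_mi \<alpha> f x\<bar> \<le> C * h ^ mi_abs \<alpha> * MM l (mi_abs \<alpha>)))}"

definition cube :: "nat \<Rightarrow> (real^'n::finite) set" where
  "cube k = {x. \<forall>i. \<bar>x $ i\<bar> < 1 / real k}"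

definition borel_map :: "((real,'n::{finite,enum}) vec \<Rightarrow> real) \<Rightarrow> ('n \<Rightarrow> nat) \<Rightarrow> real" where
  "borel_map f = (\<lambda>\<alpha>. pderiv_mi \<alpha> f 0 / fact (mi_abs \<alpha>))"

definition jet_image :: "(real \<Rightarrow> nat \<Rightarrow> real) \<Rightarrow> (('n::{finite,enum} \<Rightarrow> nat) \<Rightarrow> real) set" where
  "jet_image MM = {borel_map f | f k. k > 0 \<and> f \<in> E_roumieu MM (cube k)}"

definition seq_bounded :: "(nat \<Rightarrow> real) \<Rightarrow> real \<Rightarrow> (('n::finite \<Rightarrow> nat) \<Rightarrow> real) \<Rightarrow> bool" where
  "seq_bounded N h b \<longleftrightarrow>
     (\<exists>C. \<forall>\<alpha>. \<bar>b \<alpha>\<bar> / (h ^ mi_abs \<alpha> * (N (mi_abs \<alpha>) / fact (mi_abs \<alpha>))) \<le> C)"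

definition Lambda_roumieu :: "(real \<Rightarrow> nat \<Rightarrow> real) \<Rightarrow> (('n::finite \<Rightarrow> nat) \<Rightarrow> real) set" where
  "Lambda_roumieu NN = {b. \<exists>l>0. \<exists>h>0. seq_bounded (NN l) h b}"

definition step_ball :: "(real \<Rightarrow> nat \<Rightarrow> real) \<Rightarrow> nat \<Rightarrow> real \<Rightarrow> (('n::finite \<Rightarrow> nat) \<Rightarrow> real) set" where
  "step_ball NN n \<epsilon> = {b. \<forall>\<alpha>. \<bar>b \<alpha>\<bar> / (real n ^ mi_abs \<alpha> * (NN (real n) (mi_abs \<alpha>) / fact (mi_abs \<alpha>))) \<le> \<epsilon>}"

text \<open>Zero neighbourhood base of the locally convex inductive limit topology:
  absolutely convex subsets of \<open>\<Lambda>\<close> whose trace on each step \<open>n\<close> is a 0-neighbourhood there.\<close>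
definition LB_zero_nbhd :: "(real \<Rightarrow> nat \<Rightarrow> real) \<Rightarrow> (('n::finite \<Rightarrow> nat) \<Rightarrow> real) set \<Rightarrow> bool" where
  "LB_zero_nbhd NN W \<longleftrightarrow>
     W \<subseteq> Lambda_roumieu NN \<and>
     (\<forall>v\<in>W. \<forall>w\<in>W. \<forall>t. 0 \<le> t \<and> t \<le> 1 \<longrightarrow> (\<lambda>\<alpha>. t * v \<alpha> + (1 - t) * w \<alpha>) \<in> W) \<and>
     (\<forall>w\<in>W. \<forall>c. \<bar>c\<bar> \<le> 1 \<longrightarrow> (\<lambda>\<alpha>. c * w \<alpha>) \<in> W) \<and>
     (\<forall>n>0. \<exists>\<epsilon>>0. step_ball NN n \<epsilon> \<subseteq> W)"

definition LB_dense :: "(real \<Rightarrow> nat \<Rightarrow> real) \<Rightarrow> (('n::finite \<Rightarrow> nat) \<Rightarrow> real) set \<Rightarrow> bool" where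
  "LB_dense NN D \<longleftrightarrow> D \<subseteq> Lambda_roumieu NN \<and>
     (\<forall>b\<in>Lambda_roumieu NN. \<forall>W. LB_zero_nbhd NN W \<longrightarrow> (\<exists>d\<in>D. (\<lambda>\<alpha>. d \<alpha> - b \<alpha>) \<in> W))"

end

theory Submission
  imports Defs
begin

text \<open>
  The key is a theorem of Bang: if all derivatives of a quasianalytic function \<open>f\<close> are positive
  at \<open>0\<close>, then they stay positive on \<open>[0, \<delta>]\<close>. Otherwise, replacing \<open>f\<close> by a derivative that has
  a zero, the mean value theorem yields a decreasing sequence of zeros \<open>\<xi>\<^sub>n\<close> of \<open>f\<^sup>(\<^sup>n\<^sup>)\<close>,
  and quasianalyticity forces \<open>f\<close> to be flat at \<open>\<xi>\<^sub>0\<close>, hence zero.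
  Positivity and Taylor's formula bound \<open>f\<^sup>(\<^sup>n\<^sup>)(0) \<delta>\<^sup>n / n!\<close> by \<open>f \<delta>\<close>. Given \<open>b\<close> in the
  image of the Borel map, perturb it to \<open>b + \<epsilon> a\<close> with \<open>a\<^sub>\<alpha>\<close> the weight \<open>n\<^sub>|\<^sub>\<alpha>\<^sub>|\<close> of \<open>N\<^sup>(\<^sup>1\<^sup>)\<close>. If this were
  also a jet, the difference of the two functions, restricted to a coordinate axis, would contradict
  the unboundedness of the roots of \<open>n\<^sub>k\<close>.
\<close>

section \<open>Log-convex sequences and exponential sums\<close>

lemma log_convex_ratio_mono:
  fixes M :: "nat \<Rightarrow> real"
  assumes pos: "\<And>j. M j > 0" and lc: "\<And>j. (M (Suc j))\<^sup>2 \<le> M j * M (Suc (Suc j))"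
  shows "mono (\<lambda>j. M (Suc j) / M j)"
proof (rule mono_iff_le_Suc[THEN iffD2], rule allI)
  fix j
  show "M (Suc j) / M j \<le> M (Suc (Suc j)) / M (Suc j)"
    using lc[of j] pos[of j] pos[of "Suc j"] by (simp add: field_simps power2_eq_square)
qed

text \<open>The quotients \<open>M (Suc j) / M j\<close> increase, so each of the \<open>i\<close>
  steps up from \<open>M j\<close> costs at most the quotient at \<open>q\<close>; the restriction
  on \<open>j + i\<close> keeps every quotient involved at an index of at most
  \<open>q\<close>.\<close>

lemma log_convex_growth:
  fixes M :: "nat \<Rightarrow> real"
  assumes pos: "\<And>j. M j > 0" and lc: "\<And>j. (M (Suc j))\<^sup>2 \<le> M j * M (Suc (Suc j))"
    and "j + i \<le> Suc q"
  shows "M (j + i) \<le> M j * (M (Suc q) / M q) ^ i"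
  using \<open>j + i \<le> Suc q\<close>
proof (induction i)
  case (Suc i)
  have "M (Suc (j + i)) / M (j + i) \<le> M (Suc q) / M q"
    using log_convex_ratio_mono[of M, OF pos lc] Suc.prems by (auto simp: mono_def)
  then have "M (j + Suc i) \<le> M (j + i) * (M (Suc q) / M q)"
    using pos[of "j + i"] by (simp add: field_simps)
  also have "\<dots> \<le> M j * (M (Suc q) / M q) ^ i * (M (Suc q) / M q)"
    using Suc pos[of q] pos[of "Suc q"] by (intro mult_right_mono) auto
  finally show ?case by (simp add: mult_ac)
qed simp

lemma sum_power_fact_le_exp:
  fixes y :: real
  assumes "0 \<le> y"
  shows "(\<Sum>i<n. y ^ i / fact i) \<le> exp y"
proof -
  have "(\<Sum>i<n. y ^ i /\<^sub>R fact i) \<le> (\<Sum>i. y ^ i /\<^sub>R fact i)"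
    using assms by (intro sum_le_suminf summable_exp_generic) auto
  then show ?thesis by (simp add: exp_def divide_inverse mult.commute)
qed

section \<open>Bang's propagation of smallness\<close>

text \<open>Expand \<open>F j\<close> at \<open>p\<close>. By log-convexity the \<open>i\<close>-th
  term is at most a common factor times \<open>y ^ i / fact i\<close>, where \<open>y\<close> is the
  exponent in the claim, and these quotients sum to at most \<open>exp y\<close>.\<close>

lemma bang_taylor_step:
  fixes F :: "nat \<Rightarrow> real \<Rightarrow> real" and M :: "nat \<Rightarrow> real"
  assumes D: "\<And>j t. a \<le> t \<Longrightarrow> t \<le> b \<Longrightarrow> (F j has_real_derivative F (Suc j) t) (at t)"
    and bd: "\<And>j t. a \<le> t \<Longrightarrow> t \<le> b \<Longrightarrow> \<bar>F j t\<bar> \<le> M j"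
    and pos: "\<And>j. M j > 0" and lc: "\<And>j. (M (Suc j))\<^sup>2 \<le> M j * M (Suc (Suc j))"
    and "j \<le> q" "a \<le> p" "p \<le> x" "x \<le> b"
    and \<beta>: "exp (- real (Suc q)) \<le> \<beta>"
    and at_p: "\<And>i. j \<le> i \<Longrightarrow> \<bar>F i p\<bar> \<le> exp (real i) * M i * \<beta>"
  shows "\<bar>F j x\<bar> \<le> exp (real j) * M j * \<beta> * exp (exp 1 * (M (Suc q) / M q) * (x - p))"
proof (cases "x = p")
  case True
  then show ?thesis using at_p[of j] by simp
next
  case False
  \<comment> \<open>With this \<open>n\<close> the Lagrange remainder has order
    \<open>j + n = Suc q\<close>, where the lower bound on \<beta> makes
    \<open>exp (real (Suc q)) * \<beta>\<close> at least 1, so that \<open>bd\<close> controls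
    it.\<close>
  define n where "n = Suc q - j"
  define R where "R = M (Suc q) / M q"
  define y where "y = exp 1 * R * (x - p)"
  have \<beta>0: "\<beta> > 0" using \<beta> exp_gt_zero[of "- real (Suc q)"] by linarith
  have R0: "R > 0" using pos by (simp add: R_def)
  have xp: "x - p \<ge> 0" using assms by simp
  have y0: "y \<ge> 0" using R0 xp by (simp add: y_def)
  have "\<exists>t. (if x < p then x < t \<and> t < p else p < t \<and> t < x) \<and>
      F j x = (\<Sum>i<n. F (j + i) p / fact i * (x - p) ^ i) + F (j + n) t / fact n * (x - p) ^ n"
    using assms(5-8) False D
    by (intro Taylor[where a = a and b = b and diff = "\<lambda>i. F (j + i)"]) (auto simp: n_def)
  then obtain t where t: "p < t" "t < x"
    and eq: "F j x = (\<Sum>i<n. F (j + i) p / fact i * (x - p) ^ i) + F (j + n) t / fact n * (x - p) ^ n"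
    using \<open>p \<le> x\<close> by auto
  \<comment> \<open>The free \<open>v\<close> lets one estimate serve both the coefficients at
    \<open>p\<close> and the remainder at \<open>t\<close>.\<close>
  have main: "\<bar>v / fact i * (x - p) ^ i\<bar> \<le> exp (real j) * M j * \<beta> * (y ^ i / fact i)"
    if v: "\<bar>v\<bar> \<le> exp (real (j + i)) * M (j + i) * \<beta>" and i: "i \<le> n" for v i
  proof -
    have "M (j + i) \<le> M j * R ^ i"
      unfolding R_def using i \<open>j \<le> q\<close> by (intro log_convex_growth pos lc) (auto simp: n_def)
    then have "exp (real (j + i)) * M (j + i) * \<beta> \<le> exp (real (j + i)) * (M j * R ^ i) * \<beta>"
      using \<beta>0 by (intro mult_right_mono mult_left_mono) auto
    with v have "\<bar>v\<bar> \<le> exp (real (j + i)) * (M j * R ^ i) * \<beta>" by linarith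
    then have "\<bar>v\<bar> / fact i * (x - p) ^ i \<le> exp (real (j + i)) * (M j * R ^ i) * \<beta> / fact i * (x - p) ^ i"
      using xp by (intro mult_right_mono divide_right_mono) auto
    also have "exp (real (j + i)) = exp (real j) * exp 1 ^ i"
      by (simp add: exp_add flip: exp_of_nat_mult)
    finally show ?thesis using xp by (simp add: y_def abs_mult power_mult_distrib mult_ac)
  qed
  have "\<bar>F (j + n) t\<bar> \<le> M (j + n)" using bd t assms(6-8) by auto
  also have "\<dots> \<le> exp (real (j + n)) * M (j + n) * \<beta>"
  proof -
    have "1 = exp (real (j + n)) * exp (- real (Suc q))"
      using \<open>j \<le> q\<close> by (simp add: n_def flip: exp_add)
    also have "\<dots> \<le> exp (real (j + n)) * \<beta>" using \<beta> by simp
    finally have "M (j + n) * 1 \<le> M (j + n) * (exp (real (j + n)) * \<beta>)"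
      by (rule mult_left_mono) (use pos less_imp_le in auto)
    then show ?thesis by (simp add: mult_ac)
  qed
  finally have rem: "\<bar>F (j + n) t / fact n * (x - p) ^ n\<bar> \<le> exp (real j) * M j * \<beta> * (y ^ n / fact n)"
    by (rule main) simp
  have "\<bar>F j x\<bar> \<le> (\<Sum>i<n. \<bar>F (j + i) p / fact i * (x - p) ^ i\<bar>) + \<bar>F (j + n) t / fact n * (x - p) ^ n\<bar>"
    unfolding eq by (intro order_trans[OF abs_triangle_ineq] add_right_mono sum_abs)
  also have "\<dots> \<le> (\<Sum>i<n. exp (real j) * M j * \<beta> * (y ^ i / fact i)) + exp (real j) * M j * \<beta> * (y ^ n / fact n)"
    by (intro add_mono sum_mono rem main at_p) auto
  also have "\<dots> = exp (real j) * M j * \<beta> * (\<Sum>i<Suc n. y ^ i / fact i)"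
    by (simp add: sum_distrib_left distrib_left)
  also have "\<dots> \<le> exp (real j) * M j * \<beta> * exp y"
    using pos[of j] \<beta>0 by (intro mult_left_mono sum_power_fact_le_exp y0) auto
  finally show ?thesis by (simp add: y_def R_def)
qed

text \<open>Descending induction on \<open>j\<close>: large orders follow from the a priori bound,
  and a lower order is expanded by \<open>bang_taylor_step\<close> at a point where all orders from
  \<open>j\<close> on are controlled. The point \<open>z\<close> may lie left of \<open>a\<close>;
  then \<open>at_z\<close> is vacuous because \<open>a \<le> \<xi> i\<close>.\<close>

lemma bang_stage:
  fixes F :: "nat \<Rightarrow> real \<Rightarrow> real" and M \<xi> :: "nat \<Rightarrow> real"
  assumes D: "\<And>j t. a \<le> t \<Longrightarrow> t \<le> b \<Longrightarrow> (F j has_real_derivative F (Suc j) t) (at t)"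
    and bd: "\<And>j t. a \<le> t \<Longrightarrow> t \<le> b \<Longrightarrow> \<bar>F j t\<bar> \<le> M j"
    and pos: "\<And>j. M j > 0" and lc: "\<And>j. (M (Suc j))\<^sup>2 \<le> M j * M (Suc (Suc j))"
    and \<xi>: "antimono \<xi>" "\<And>j. a \<le> \<xi> j" "\<And>j. F j (\<xi> j) = 0"
    and at_z: "\<And>j. \<xi> j \<le> z \<Longrightarrow> \<bar>F j z\<bar> \<le> exp (real j) * M j * exp (- real (Suc q))"
    and "z \<le> x" "x \<le> b" "\<xi> j \<le> x"
  shows "\<bar>F j x\<bar> \<le> exp (real j) * M j * (exp (- real (Suc q)) * exp (exp 1 * (M (Suc q) / M q) * (x - z)))"
  using \<open>z \<le> x\<close> \<open>x \<le> b\<close> \<open>\<xi> j \<le> x\<close>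
proof (induction "Suc q - j" arbitrary: j x rule: less_induct)
  case less
  define R where "R = M (Suc q) / M q"
  have R0: "R > 0" using pos by (simp add: R_def)
  have grow: "1 \<le> exp (exp 1 * R * (w - z))" if "z \<le> w" for w
    using that R0 by simp
  \<comment> \<open>From order \<open>Suc q\<close> on, \<open>exp (real i)\<close> compensates
    \<open>exp (- real (Suc q))\<close>, so the claimed bound is no smaller than
    \<open>M i\<close>.\<close>
  have high: "\<bar>F i w\<bar> \<le> exp (real i) * M i * (exp (- real (Suc q)) * exp (exp 1 * R * (w - z)))"
    if "Suc q \<le> i" "z \<le> w" "a \<le> w" "w \<le> b" for i w
  proof -
    have "1 \<le> exp (real i) * exp (- real (Suc q))" using that by (simp flip: exp_add)
    then have "1 * 1 \<le> (exp (real i) * exp (- real (Suc q))) * exp (exp 1 * R * (w - z))"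
      using grow[OF that(2)] by (intro mult_mono) auto
    then have "M i * 1 \<le> M i * ((exp (real i) * exp (- real (Suc q))) * exp (exp 1 * R * (w - z)))"
      using pos[of i] by (intro mult_left_mono) auto
    then show ?thesis using bd[of w i] that by (simp add: mult_ac)
  qed
  have ax: "a \<le> x" using \<xi>(2)[of j] less.prems by linarith
  show ?case
  proof (cases "Suc q \<le> j")
    case True
    then show ?thesis using high[of j x] less.prems ax by (simp add: R_def)
  next
    case False
    \<comment> \<open>The leftmost point at which the claim speaks about order \<open>j\<close>:
      there \<open>F j\<close> either vanishes or is bounded by \<open>at_z\<close>.\<close>
    define p where "p = max z (\<xi> j)"
    define \<beta> where "\<beta> = exp (- real (Suc q)) * exp (exp 1 * R * (p - z))"
    have p: "z \<le> p" "\<xi> j \<le> p" "p \<le> x" "a \<le> p" "p \<le> b"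
      using less.prems \<xi>(2)[of j] by (auto simp: p_def)
    have at_p: "\<bar>F i p\<bar> \<le> exp (real i) * M i * \<beta>" if "j \<le> i" for i
    proof (cases "i = j")
      case True
      show ?thesis
      proof (cases "\<xi> j \<le> z")
        case True
        then show ?thesis using at_z[of j] \<open>i = j\<close> by (simp add: \<beta>_def p_def max_def)
      next
        case False
        then show ?thesis using \<xi>(3)[of j] \<open>i = j\<close> pos[of j] by (simp add: \<beta>_def p_def max_def)
      qed
    next
      case False
      \<comment> \<open>Zeros of higher derivatives lie further left, so the induction hypothesis
        applies at \<open>p\<close> itself.\<close>
      have "\<xi> i \<le> \<xi> j" using \<xi>(1) that by (auto simp: antimono_def)
      then show ?thesis unfolding \<beta>_def R_def
        using False that \<open>\<not> Suc q \<le> j\<close> p by (intro less.hyps) auto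
    qed
    have "\<bar>F j x\<bar> \<le> exp (real j) * M j * \<beta> * exp (exp 1 * R * (x - p))"
      unfolding R_def
    proof (rule bang_taylor_step[where F = F and M = M and a = a and b = b, OF D bd pos lc])
      show "exp (- real (Suc q)) \<le> \<beta>"
        unfolding \<beta>_def using mult_left_mono[OF grow[OF p(1)], of "exp (- real (Suc q))"] by simp
    qed (use False p less.prems at_p in auto)
    also have "\<dots> = exp (real j) * M j * (exp (- real (Suc q)) * exp (exp 1 * R * (x - z)))"
      by (simp add: \<beta>_def algebra_simps flip: exp_add)
    finally show ?thesis by (simp add: R_def)
  qed
qed

text \<open>Bang's argument: while all relevant derivatives are below \<open>e\<^sup>-\<^sup>m\<close> times their natural size,
  gaining a factor \<open>e\<close> costs a distance \<open>M\<^sub>m\<^sub>-\<^sub>1 / (e M\<^sub>m)\<close>. These distances have a divergent sum,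
  so any prescribed smallness at \<open>x\<close> is traced back to a vacuous condition left of \<open>a\<close>.\<close>

lemma bang_vanishing:
  fixes F :: "nat \<Rightarrow> real \<Rightarrow> real" and M \<xi> :: "nat \<Rightarrow> real"
  assumes D: "\<And>j t. a \<le> t \<Longrightarrow> t \<le> b \<Longrightarrow> (F j has_real_derivative F (Suc j) t) (at t)"
    and bd: "\<And>j t. a \<le> t \<Longrightarrow> t \<le> b \<Longrightarrow> \<bar>F j t\<bar> \<le> M j"
    and pos: "\<And>j. M j > 0" and lc: "\<And>j. (M (Suc j))\<^sup>2 \<le> M j * M (Suc (Suc j))"
    and qa: "\<not> summable (\<lambda>p. M p / M (Suc p))"
    and \<xi>: "antimono \<xi>" "\<And>j. a \<le> \<xi> j" "\<And>j. F j (\<xi> j) = 0"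
    and "\<xi> 0 \<le> x" "x \<le> b"
  shows "F j x = 0"
proof -
  have small: "\<bar>F i x\<bar> \<le> exp (real i) * M i * exp (- real m)" for i m
  proof -
    \<comment> \<open>The points descend from \<open>z 0 = x\<close>. With \<open>q = m + k\<close>,
      the gap between \<open>z (Suc k)\<close> and \<open>z k\<close> is the distance over which the
      growth factor of \<open>bang_stage\<close> equals \<open>exp 1\<close>.\<close>
    define z where "z k = x - (\<Sum>p<k. M (m + p) / M (Suc (m + p))) / exp 1" for k
    have "\<exists>k. z k < a"
    proof (rule ccontr)
      assume "\<nexists>k. z k < a"
      then have "(\<Sum>p<k. M (m + p) / M (Suc (m + p))) \<le> exp 1 * (x - a)" for k
        by (auto simp: z_def field_simps not_less)
      then have "summable (\<lambda>p. M (m + p) / M (Suc (m + p)))"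
        by (intro summableI_nonneg_bounded[where x = "exp 1 * (x - a)"]) (auto simp: pos less_imp_le)
      then show False using qa summable_iff_shift[of "\<lambda>p. M p / M (Suc p)" m]
        by (simp add: add.commute)
    qed
    then obtain K where K: "z K < a" by blast
    have z_Suc: "z k - z (Suc k) = M (m + k) / M (Suc (m + k)) / exp 1" for k
      by (simp add: z_def add_divide_distrib)
    have z_le: "z k \<le> x" for k
      by (auto simp: z_def intro!: sum_nonneg divide_nonneg_pos less_imp_le[OF pos] pos)
    \<comment> \<open>The induction on \<open>k\<close> moves right from \<open>z K\<close> to
      \<open>z 0\<close>. It starts vacuously, since \<open>z K < a \<le> \<xi> j\<close>, and each
      step lowers the smallness index by one.\<close>
    have "\<forall>j. \<xi> j \<le> z (K - k) \<longrightarrow> \<bar>F j (z (K - k))\<bar> \<le> exp (real j) * M j * exp (- real (m + (K - k)))"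
      if "k \<le> K" for k
      using that
    proof (induction k)
      case 0
      show ?case
      proof (intro allI impI)
        fix j assume "\<xi> j \<le> z (K - 0)"
        then show "\<bar>F j (z (K - 0))\<bar> \<le> exp (real j) * M j * exp (- real (m + (K - 0)))"
          using K \<xi>(2)[of j] by simp
      qed
    next
      case (Suc k)
      define l where "l = K - Suc k"
      have l: "K - k = Suc l" using Suc.prems by (simp add: l_def)
      show ?case
      proof (intro allI impI)
        fix j assume j: "\<xi> j \<le> z (K - Suc k)"
        have "\<bar>F j (z l)\<bar> \<le> exp (real j) * M j * (exp (- real (Suc (m + l))) *
            exp (exp 1 * (M (Suc (m + l)) / M (m + l)) * (z l - z (Suc l))))"
        proof (rule bang_stage[where F = F and M = M and a = a and b = b, OF D bd pos lc \<xi>])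
          show "z (Suc l) \<le> z l"
            using z_Suc[of l] pos[of "m + l"] pos[of "Suc (m + l)"]
            by (metis diff_ge_0_iff_ge divide_nonneg_nonneg exp_ge_zero less_imp_le)
          show "\<bar>F i (z (Suc l))\<bar> \<le> exp (real i) * M i * exp (- real (Suc (m + l)))"
            if "\<xi> i \<le> z (Suc l)" for i
            using Suc.IH Suc.prems that l by simp
          show "z l \<le> b" using z_le[of l] \<open>x \<le> b\<close> by linarith
          show "\<xi> j \<le> z l" using j by (simp add: l_def)
        qed
        also have "exp 1 * (M (Suc (m + l)) / M (m + l)) * (z l - z (Suc l)) = 1"
          using pos[of "m + l"] pos[of "Suc (m + l)"] by (simp add: z_Suc field_simps)
        also have "exp (- real (Suc (m + l))) * exp 1 = exp (- real (m + l))"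
          by (simp flip: exp_add)
        finally show "\<bar>F j (z (K - Suc k))\<bar> \<le> exp (real j) * M j * exp (- real (m + (K - Suc k)))"
          by (simp add: l_def)
      qed
    qed
    from this[of K] have "\<forall>j. \<xi> j \<le> x \<longrightarrow> \<bar>F j x\<bar> \<le> exp (real j) * M j * exp (- real m)"
      by (simp add: z_def)
    moreover have "\<xi> i \<le> x" using antimonoD[OF \<xi>(1), of 0 i] \<open>\<xi> 0 \<le> x\<close> by simp
    ultimately show ?thesis by blast
  qed
  have "(\<lambda>m. exp (- real m)) \<longlonglongrightarrow> 0"
    by (rule filterlim_compose[OF exp_at_bot])
       (simp add: filterlim_uminus_at_bot filterlim_real_sequentially)
  then have "(\<lambda>m. exp (real j) * M j * exp (- real m)) \<longlonglongrightarrow> exp (real j) * M j * 0"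
    by (rule tendsto_mult_left)
  then have "\<bar>F j x\<bar> \<le> exp (real j) * M j * 0"
    by (rule LIMSEQ_le_const) (use small in auto)
  then show ?thesis by simp
qed

section \<open>Positivity of quasianalytic functions with positive jets\<close>

text \<open>Reflecting \<open>t\<close> to \<open>- t\<close> reduces this to
  \<open>bang_vanishing\<close>: flatness at \<open>b\<close> supplies the constant sequence of
  zeros at \<open>- b\<close>.\<close>

lemma quasianalytic_zero_leftwards:
  fixes F :: "nat \<Rightarrow> real \<Rightarrow> real" and M :: "nat \<Rightarrow> real"
  assumes D: "\<And>j t. a \<le> t \<Longrightarrow> t \<le> b \<Longrightarrow> (F j has_real_derivative F (Suc j) t) (at t)"
    and bd: "\<And>j t. a \<le> t \<Longrightarrow> t \<le> b \<Longrightarrow> \<bar>F j t\<bar> \<le> M j"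
    and pos: "\<And>j. M j > 0" and lc: "\<And>j. (M (Suc j))\<^sup>2 \<le> M j * M (Suc (Suc j))"
    and qa: "\<not> summable (\<lambda>p. M p / M (Suc p))"
    and "a \<le> b" and flat: "\<And>j. F j b = 0"
  shows "F j a = 0"
proof -
  define G where "G j t = (- 1) ^ j * F j (- t)" for j t
  have "G j (- a) = 0"
  proof (rule bang_vanishing[where F = G and M = M and a = "- b" and b = "- a" and \<xi> = "\<lambda>_. - b"])
    fix j t assume t: "- b \<le> t" "t \<le> - a"
    have "((\<lambda>t. F j (- t)) has_real_derivative F (Suc j) (- t) * (- 1)) (at t)"
      using t by (intro DERIV_chain2[OF D]) (auto intro!: derivative_eq_intros)
    from DERIV_cmult[OF this, of "(- 1) ^ j"]
    show "(G j has_real_derivative G (Suc j) t) (at t)" by (simp add: G_def [abs_def])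
    show "\<bar>G j t\<bar> \<le> M j" using bd[of "- t" j] t by (simp add: G_def abs_mult power_abs)
  qed (use pos lc qa flat \<open>a \<le> b\<close> in \<open>auto simp: G_def antimono_def\<close>)
  then show ?thesis by (simp add: G_def)
qed

lemma quasianalytic_positive_order_zero:
  fixes F :: "nat \<Rightarrow> real \<Rightarrow> real" and M :: "nat \<Rightarrow> real"
  assumes D: "\<And>j t. 0 \<le> t \<Longrightarrow> t \<le> b \<Longrightarrow> (F j has_real_derivative F (Suc j) t) (at t)"
    and bd: "\<And>j t. 0 \<le> t \<Longrightarrow> t \<le> b \<Longrightarrow> \<bar>F j t\<bar> \<le> M j"
    and pos: "\<And>j. M j > 0" and lc: "\<And>j. (M (Suc j))\<^sup>2 \<le> M j * M (Suc (Suc j))"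
    and qa: "\<not> summable (\<lambda>p. M p / M (Suc p))"
    and at_0: "\<And>j. F j 0 > 0"
    and x: "0 \<le> x" "x \<le> b"
  shows "F 0 x > 0"
proof (rule ccontr)
  assume "\<not> F 0 x > 0"
  have ivt: "\<exists>y. 0 < y \<and> y \<le> c \<and> F j y = 0" if "F j c \<le> 0" "0 \<le> c" "c \<le> b" for j c
  proof -
    have "\<exists>y\<ge>0. y \<le> c \<and> F j y = 0"
      using that at_0[of j] by (intro IVT2) (auto intro!: DERIV_isCont[OF D])
    then show ?thesis using at_0[of j] by (metis less_eq_real_def less_irrefl)
  qed
  have "\<exists>\<xi>. \<forall>n. (0 < \<xi> n \<and> \<xi> n \<le> x \<and> F n (\<xi> n) = 0) \<and> \<xi> (Suc n) \<le> \<xi> n"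
  proof (rule dependent_nat_choice)
    show "\<exists>y. 0 < y \<and> y \<le> x \<and> F 0 y = 0" using ivt[of 0 x] \<open>\<not> F 0 x > 0\<close> x by simp
    fix c n assume c: "0 < c \<and> c \<le> x \<and> F n c = 0"
    \<comment> \<open>\<open>F n\<close> falls from a positive value to 0, so its derivative is
      negative at some \<open>s < c\<close>; being positive at 0, that derivative has a zero in
      between, which is the next \<xi>.\<close>
    obtain s where s: "0 < s" "s < c" "F n c - F n 0 = (c - 0) * F (Suc n) s"
      using MVT2[of 0 c "F n" "F (Suc n)"] c x D by auto
    then have "F (Suc n) s < 0" using c at_0[of n] by (simp add: mult_less_0_iff minus_mult_right zero_less_mult_iff)
        (smt (verit) mult_nonneg_nonneg)
    then obtain y where "0 < y" "y \<le> s" "F (Suc n) y = 0" using ivt[of "Suc n" s] s c x by auto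
    then show "\<exists>y. (0 < y \<and> y \<le> x \<and> F (Suc n) y = 0) \<and> y \<le> c" using s c by auto
  qed
  then obtain \<xi> where \<xi>: "\<And>n. 0 < \<xi> n" "\<And>n. \<xi> n \<le> x" "\<And>n. F n (\<xi> n) = 0" "\<And>n. \<xi> (Suc n) \<le> \<xi> n"
    by blast
  \<comment> \<open>The zeros force flatness at \<open>x\<close>, which then travels left to 0 and
    contradicts the positive jet.\<close>
  have "F j x = 0" for j
    by (rule bang_vanishing[where F = F and M = M and a = 0 and b = b and \<xi> = \<xi>, OF D bd pos lc qa])
       (use \<xi> x in \<open>auto simp: less_imp_le decseq_Suc_iff\<close>)
  then have "F 0 0 = 0"
    using x by (intro quasianalytic_zero_leftwards[where F = F and M = M and a = 0 and b = x, OF D bd pos lc qa]) auto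
  then show False using at_0[of 0] by simp
qed

text \<open>The hypotheses survive an index shift of \<open>F\<close> and \<open>M\<close>, since
  divergence depends only on the tail of the series.\<close>

lemma quasianalytic_positive:
  fixes F :: "nat \<Rightarrow> real \<Rightarrow> real" and M :: "nat \<Rightarrow> real"
  assumes D: "\<And>j t. 0 \<le> t \<Longrightarrow> t \<le> b \<Longrightarrow> (F j has_real_derivative F (Suc j) t) (at t)"
    and bd: "\<And>j t. 0 \<le> t \<Longrightarrow> t \<le> b \<Longrightarrow> \<bar>F j t\<bar> \<le> M j"
    and pos: "\<And>j. M j > 0" and lc: "\<And>j. (M (Suc j))\<^sup>2 \<le> M j * M (Suc (Suc j))"
    and qa: "\<not> summable (\<lambda>p. M p / M (Suc p))"
    and at_0: "\<And>j. F j 0 > 0"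
    and x: "0 \<le> x" "x \<le> b"
  shows "F n x > 0"
proof -
  have "F (n + 0) x > 0"
  proof (rule quasianalytic_positive_order_zero[where F = "\<lambda>j. F (n + j)" and M = "\<lambda>j. M (n + j)"])
    show "\<not> summable (\<lambda>p. M (n + p) / M (n + Suc p))"
      using qa summable_iff_shift[of "\<lambda>p. M p / M (Suc p)" n] by (simp add: add.commute)
  qed (use D bd pos lc at_0 x in auto)
  then show ?thesis by simp
qed

text \<open>In Taylor's formula at 0 every term, remainder included, is nonnegative, so a single
  term is at most the whole value.\<close>

lemma quasianalytic_positive_jet_bound:
  fixes F :: "nat \<Rightarrow> real \<Rightarrow> real" and M :: "nat \<Rightarrow> real"
  assumes D: "\<And>j t. 0 \<le> t \<Longrightarrow> t \<le> b \<Longrightarrow> (F j has_real_derivative F (Suc j) t) (at t)"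
    and bd: "\<And>j t. 0 \<le> t \<Longrightarrow> t \<le> b \<Longrightarrow> \<bar>F j t\<bar> \<le> M j"
    and pos: "\<And>j. M j > 0" and lc: "\<And>j. (M (Suc j))\<^sup>2 \<le> M j * M (Suc (Suc j))"
    and qa: "\<not> summable (\<lambda>p. M p / M (Suc p))"
    and at_0: "\<And>j. F j 0 > 0" and "b > 0"
  shows "F k 0 / fact k * b ^ k \<le> F 0 b"
proof -
  have "\<exists>t. 0 < t \<and> t < b \<and> F 0 b = (\<Sum>i<Suc k. F i 0 / fact i * (b - 0) ^ i) + F (Suc k) t / fact (Suc k) * (b - 0) ^ Suc k"
    using D \<open>b > 0\<close> by (intro Taylor_up[where a = 0]) auto
  then obtain t where t: "0 < t" "t < b"
    and eq: "F 0 b = (\<Sum>i<Suc k. F i 0 / fact i * b ^ i) + F (Suc k) t / fact (Suc k) * b ^ Suc k"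
    by auto
  have "F (Suc k) t > 0"
    using t by (intro quasianalytic_positive[where F = F and M = M and b = b, OF D bd pos lc qa at_0]) auto
  then have "F (Suc k) t / fact (Suc k) * b ^ Suc k \<ge> 0" using \<open>b > 0\<close> by simp
  moreover have "(\<Sum>i<k. F i 0 / fact i * b ^ i) \<ge> 0"
    using at_0 \<open>b > 0\<close> by (intro sum_nonneg) (auto simp: less_imp_le)
  ultimately show ?thesis using eq by simp
qed

section \<open>Restriction to a coordinate axis\<close>

lemma foldr_funpow_singleton:
  assumes "distinct xs"
  shows "foldr (\<lambda>k g. (f k ^^ (if k = i then j else 0)) g) xs g = (if i \<in> set xs then (f i ^^ j) g else g)"
  using assms by (induction xs) auto

text \<open>The enumeration contains each index exactly once, so only the factor in direction
  \<open>i\<close> survives.\<close>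

lemma pderiv_mi_axis:
  "pderiv_mi (\<lambda>k. if k = i then j else 0) f = (pderiv1 i ^^ j) f"
  unfolding pderiv_mi_def
  by (subst foldr_funpow_singleton) (auto simp: enum_distinct UNIV_enum[symmetric])

lemma mi_abs_axis [simp]: "mi_abs (\<lambda>k. if k = i then j else 0) = j"
  by (simp add: mi_abs_def)

lemma Ck_on_funpow_pderiv1:
  "Ck_on (j + k) U f \<Longrightarrow> Ck_on k U ((pderiv1 i ^^ j) f)"
proof (induction j arbitrary: k)
  case (Suc j)
  have "Ck_on (Suc k) U ((pderiv1 i ^^ j) f)"
    by (rule Suc.IH) (use Suc.prems in \<open>simp only: add_Suc add_Suc_right\<close>)
  then show ?case by simp
qed simp

lemma open_cube: "open (cube k :: (real^'n::finite) set)"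
proof -
  have "cube k = (\<Inter>i. {x::real^'n. \<bar>x $ i\<bar> < 1 / real k})" by (auto simp: cube_def)
  also have "open \<dots>"
    by (intro open_INT ballI open_Collect_less continuous_intros) auto
  finally show ?thesis .
qed

lemma axis_derivative:
  fixes f :: "real^'n::finite \<Rightarrow> real"
  assumes "f differentiable_on U" "open U" "t *\<^sub>R axis i 1 \<in> U"
  shows "((\<lambda>t. f (t *\<^sub>R axis i 1)) has_real_derivative pderiv1 i f (t *\<^sub>R axis i 1)) (at t)"
proof -
  let ?x = "t *\<^sub>R axis i 1 :: real^'n"
  have "f differentiable (at ?x)"
    using assms by (simp add: differentiable_on_eq_differentiable_at)
  then have df: "(f has_derivative frechet_derivative f (at ?x)) (at ?x)"
    by (simp add: frechet_derivative_works)
  have "((\<lambda>t. f (t *\<^sub>R axis i 1)) has_derivative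
      (\<lambda>s. frechet_derivative f (at ?x) (s *\<^sub>R axis i 1))) (at t)"
    by (rule has_derivative_compose[where f = "\<lambda>t. t *\<^sub>R axis i 1" and g = f, OF _ df]) (auto intro!: derivative_eq_intros)
  moreover have "(\<lambda>s. frechet_derivative f (at ?x) (s *\<^sub>R axis i 1)) = (*) (pderiv1 i f ?x)"
    using linear_scale[OF has_derivative_linear[OF df]] by (auto simp: pderiv1_def mult.commute)
  ultimately show ?thesis by (simp add: has_field_derivative_def)
qed

text \<open>Supplies the one-variable data for Bang's argument. A closed segment of the axis is
  compact, so one choice of constants serves all orders; \<open>fact j\<close> undoes the
  normalisation in \<open>borel_map\<close>.\<close>

lemma E_roumieu_axis_restriction:
  fixes f :: "(real,'n::{finite,enum}) vec \<Rightarrow> real" and i :: 'n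
  assumes f: "f \<in> E_roumieu MM (cube k)" and "k > 0" "weight_matrix MM"
  obtains l h C :: real and F :: "nat \<Rightarrow> real \<Rightarrow> real" where "l > 0" "h > 0" "C > 0"
    "\<forall>j. \<forall>t\<in>{0..1 / (2 * real k)}. (F j has_real_derivative F (Suc j) t) (at t)"
    "\<forall>j. \<forall>t\<in>{0..1 / (2 * real k)}. \<bar>F j t\<bar> \<le> C * h ^ j * MM l j"
    "\<forall>j. F j 0 = fact j * borel_map f (\<lambda>m. if m = i then j else 0)"
proof -
  define e :: "(real,'n) vec" where "e = axis i 1"
  define F where "F j t = (pderiv1 i ^^ j) f (t *\<^sub>R e)" for j t
  \<comment> \<open>Stopping halfway to the boundary keeps the segment inside the open cube.\<close>
  define K where "K = (\<lambda>t. t *\<^sub>R e) ` {0..1 / (2 * real k)}"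
  have in_cube: "t *\<^sub>R e \<in> cube k" if "0 \<le> t" "t \<le> 1 / (2 * real k)" for t
  proof -
    have "1 / (2 * real k) < 1 / real k" using \<open>k > 0\<close> by (simp add: field_simps)
    then show ?thesis using that \<open>k > 0\<close> by (auto simp: cube_def e_def axis_def)
  qed
  have "compact K"
    unfolding K_def by (intro compact_continuous_image continuous_intros) auto
  moreover have "K \<subseteq> cube k" using in_cube by (auto simp: K_def)
  ultimately have "\<exists>l>0. \<exists>h>0. \<exists>C. \<forall>\<alpha>. \<forall>x\<in>K.
      \<bar>pderiv_mi \<alpha> f x\<bar> \<le> C * h ^ mi_abs \<alpha> * MM l (mi_abs \<alpha>)"
    using f by (simp add: E_roumieu_def)
  then obtain l h C where lh: "l > 0" "h > 0"
    and C: "\<And>\<alpha> x. x \<in> K \<Longrightarrow> \<bar>pderiv_mi \<alpha> f x\<bar> \<le> C * h ^ mi_abs \<alpha> * MM l (mi_abs \<alpha>)"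
    by blast
  show thesis
  proof (rule that[of l h "\<bar>C\<bar> + 1" F])
    show "\<forall>j. \<forall>t\<in>{0..1 / (2 * real k)}. (F j has_real_derivative F (Suc j) t) (at t)"
    proof (intro allI ballI)
      fix j t assume t: "t \<in> {0..1 / (2 * real k)}"
      have "Ck_on (j + 1) (cube k) f" using f by (simp add: E_roumieu_def smooth_on_def)
      then have "Ck_on 1 (cube k) ((pderiv1 i ^^ j) f)" by (rule Ck_on_funpow_pderiv1)
      then have "(pderiv1 i ^^ j) f differentiable_on cube k" by simp
      from axis_derivative[OF this open_cube, of t i] in_cube[of t] t
      show "(F j has_real_derivative F (Suc j) t) (at t)"
        by (simp add: F_def [abs_def] e_def)
    qed
    show "\<forall>j. \<forall>t\<in>{0..1 / (2 * real k)}. \<bar>F j t\<bar> \<le> (\<bar>C\<bar> + 1) * h ^ j * MM l j"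
    proof (intro allI ballI)
      fix j t assume t: "t \<in> {0..1 / (2 * real k)}"
      have Mpos: "MM l j > 0"
        using \<open>weight_matrix MM\<close> lh by (auto simp: weight_matrix_def weight_seq_def)
      have "t *\<^sub>R e \<in> K" using t by (auto simp: K_def)
      from C[OF this, of "\<lambda>m. if m = i then j else 0"]
      have "\<bar>F j t\<bar> \<le> C * (h ^ j * MM l j)"
        by (simp add: pderiv_mi_axis F_def mult_ac)
      also have "\<dots> \<le> (\<bar>C\<bar> + 1) * (h ^ j * MM l j)"
        using Mpos lh by (intro mult_right_mono) auto
      finally show "\<bar>F j t\<bar> \<le> (\<bar>C\<bar> + 1) * h ^ j * MM l j" by (simp add: mult_ac)
    qed
  qed (use lh in \<open>auto simp: F_def borel_map_def pderiv_mi_axis\<close>)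
qed

section \<open>Comparison of two jets\<close>

lemma weight_matrix_mono_bound:
  assumes "weight_matrix MM" "0 < l" "l \<le> l'" "0 < h" "h \<le> h'" "0 \<le> C"
  shows "C * h ^ j * MM l j \<le> C * h' ^ j * MM l' j"
proof -
  have "MM l j \<le> MM l' j" "0 < MM l j"
    using assms by (auto simp: weight_matrix_def weight_seq_def)
  then show ?thesis using assms by (intro mult_mono power_mono) auto
qed

text \<open>Along the axis the difference of the two representing functions has positive derivatives
  at 0, so \<open>quasianalytic_positive_jet_bound\<close> applies; \<open>A\<close> comes from its
  value at \<delta>.\<close>

lemma jet_image_difference_positive_bound:
  fixes b c :: "('n::{finite,enum} \<Rightarrow> nat) \<Rightarrow> real" and i :: 'n
  assumes MM: "weight_matrix MM" "quasianalytic_matrix MM"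
    and b: "b \<in> jet_image MM" and c: "c \<in> jet_image MM"
    and pos: "\<And>j. c (\<lambda>m. if m = i then j else 0) - b (\<lambda>m. if m = i then j else 0) > 0"
  obtains \<delta> A where "\<delta> > 0" "A > 0"
    "\<And>j. (c (\<lambda>m. if m = i then j else 0) - b (\<lambda>m. if m = i then j else 0)) * \<delta> ^ j \<le> A"
proof -
  obtain f k where f: "f \<in> E_roumieu MM (cube k)" "k > 0" and bf: "b = borel_map f"
    using b by (auto simp: jet_image_def)
  obtain g k' where g: "g \<in> E_roumieu MM (cube k')" "k' > 0" and cg: "c = borel_map g"
    using c by (auto simp: jet_image_def)
  obtain l h C F where lhC: "l > 0" "h > 0" "C > 0"
    and F: "\<forall>j. \<forall>t\<in>{0..1 / (2 * real k)}. (F j has_real_derivative F (Suc j) t) (at t)"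
    "\<forall>j. \<forall>t\<in>{0..1 / (2 * real k)}. \<bar>F j t\<bar> \<le> C * h ^ j * MM l j"
    "\<forall>j. F j 0 = fact j * borel_map f (\<lambda>m. if m = i then j else 0)"
    by (rule E_roumieu_axis_restriction[OF f MM(1), of i]) (rule that)
  obtain l' h' C' G where lhC': "l' > 0" "h' > 0" "C' > 0"
    and G: "\<forall>j. \<forall>t\<in>{0..1 / (2 * real k')}. (G j has_real_derivative G (Suc j) t) (at t)"
    "\<forall>j. \<forall>t\<in>{0..1 / (2 * real k')}. \<bar>G j t\<bar> \<le> C' * h' ^ j * MM l' j"
    "\<forall>j. G j 0 = fact j * borel_map g (\<lambda>m. if m = i then j else 0)"
    by (rule E_roumieu_axis_restriction[OF g MM(1), of i]) (rule that)
  define \<delta> where "\<delta> = min (1 / (2 * real k)) (1 / (2 * real k'))"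
  define H where "H j t = G j t - F j t" for j t
  define L where "L = max l l'"
  \<comment> \<open>The two functions may use different matrix members and geometric rates.
    Monotonicity of the matrix puts both under the member at \<open>L\<close>, which is again
    quasianalytic.\<close>
  define W where "W j = (C + C') * (max h h') ^ j * MM L j" for j
  have "\<delta> > 0" using f g by (simp add: \<delta>_def)
  have L: "L > 0" using lhC by (simp add: L_def)
  have Mpos: "MM L j > 0" for j using MM(1) L by (auto simp: weight_matrix_def weight_seq_def)
  have hpos: "max h h' > 0" using lhC by auto
  have H0: "H j 0 = fact j * (c (\<lambda>m. if m = i then j else 0) - b (\<lambda>m. if m = i then j else 0))" for j
    by (simp add: H_def F G bf cg algebra_simps)
  have bound: "H j 0 / fact j * \<delta> ^ j \<le> H 0 \<delta>" for j
  proof (rule quasianalytic_positive_jet_bound[where M = W])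
    fix j t assume t: "0 \<le> t" "t \<le> \<delta>"
    then show "(H j has_real_derivative H (Suc j) t) (at t)"
      unfolding H_def [abs_def] by (intro DERIV_diff F(1)[rule_format] G(1)[rule_format]) (auto simp: \<delta>_def)
    have "\<bar>F j t\<bar> \<le> C * (max h h') ^ j * MM L j"
      using t lhC by (intro order_trans[OF F(2)[rule_format] weight_matrix_mono_bound[OF MM(1)]]) (auto simp: \<delta>_def L_def)
    moreover have "\<bar>G j t\<bar> \<le> C' * (max h h') ^ j * MM L j"
      using t lhC' by (intro order_trans[OF G(2)[rule_format] weight_matrix_mono_bound[OF MM(1)]]) (auto simp: \<delta>_def L_def)
    ultimately show "\<bar>H j t\<bar> \<le> W j" by (simp add: H_def W_def algebra_simps)
  next
    fix j
    show "W j > 0" using lhC lhC' Mpos hpos by (simp add: W_def)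
    have "(MM L (Suc j))\<^sup>2 \<le> MM L j * MM L (Suc (Suc j))"
      using MM(1) L unfolding weight_matrix_def weight_seq_def
      by (metis Suc_eq_plus1 diff_Suc_1 le_add2)
    then have "((C + C') * (max h h') ^ Suc j)\<^sup>2 * (MM L (Suc j))\<^sup>2
        \<le> ((C + C') * (max h h') ^ Suc j)\<^sup>2 * (MM L j * MM L (Suc (Suc j)))"
      by (rule mult_left_mono) simp
    then show "(W (Suc j))\<^sup>2 \<le> W j * W (Suc (Suc j))"
      by (simp add: W_def power2_eq_square mult_ac)
  next
    \<comment> \<open>The constant cancels and the geometric factor only rescales the series, so
      divergence persists.\<close>
    have "(\<lambda>p. W p / W (Suc p)) = (\<lambda>p. (MM L p / MM L (Suc p)) / max h h')"
      using hpos lhC lhC' by (simp add: W_def mult.commute)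
    moreover have "\<not> summable (\<lambda>p. MM L p / MM L (Suc p))"
      using MM(2) L by (auto simp: quasianalytic_matrix_def quasianalytic_seq_def)
    ultimately show "\<not> summable (\<lambda>p. W p / W (Suc p))"
      using hpos by (simp only: summable_divide_iff) simp
  next
    show "H j 0 > 0" for j using pos[of j] by (simp add: H0)
  qed fact
  show thesis
  proof (rule that[OF \<open>\<delta> > 0\<close>])
    show "\<bar>H 0 \<delta>\<bar> + 1 > 0" by simp
    show "(c (\<lambda>m. if m = i then j else 0) - b (\<lambda>m. if m = i then j else 0)) * \<delta> ^ j \<le> \<bar>H 0 \<delta>\<bar> + 1" for j
      using bound[of j] by (simp add: H0)
  qed
qed

section \<open>Density of the complement of the jet image\<close>

theorem mainTheorem13:
  fixes MM NN :: "real \<Rightarrow> nat \<Rightarrow> real"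
  assumes "weight_matrix MM" and "quasianalytic_matrix MM"
    and "weight_matrix NN" and "quasianalytic_matrix NN"
    and "\<forall>l>0. \<forall>C. \<exists>k>0. root k (NN l k / fact k) > C"
  shows "LB_dense NN (Lambda_roumieu NN - (jet_image MM :: (('n::{finite,enum} \<Rightarrow> nat) \<Rightarrow> real) set))"
  unfolding LB_dense_def
proof (intro conjI ballI allI impI)
  fix b :: "('n \<Rightarrow> nat) \<Rightarrow> real" and W :: "(('n \<Rightarrow> nat) \<Rightarrow> real) set"
  assume b: "b \<in> Lambda_roumieu NN" and W: "LB_zero_nbhd NN W"
  have Npos: "NN l p > 0" if "l > 0" for l p
    using assms(3) that by (auto simp: weight_matrix_def weight_seq_def)
  \<comment> \<open>The perturbation will be taken from step 1, and \<epsilon> fixes its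
    size.\<close>
  obtain \<epsilon> where \<epsilon>: "\<epsilon> > 0" "step_ball NN 1 \<epsilon> \<subseteq> W"
    using W unfolding LB_zero_nbhd_def by (metis zero_less_one)
  show "\<exists>d\<in>Lambda_roumieu NN - jet_image MM. (\<lambda>\<alpha>. d \<alpha> - b \<alpha>) \<in> W"
  proof (cases "b \<in> jet_image MM")
    case False
    have "(\<lambda>\<alpha>. b \<alpha> - b \<alpha>) \<in> step_ball NN 1 \<epsilon>" using \<epsilon> by (simp add: step_ball_def)
    then show ?thesis using False b \<epsilon> by blast
  next
    case True
    \<comment> \<open>Every entry is as large as the ball of radius \<epsilon> in step 1 allows, and
      positive, as the comparison of jets requires.\<close>
    define a :: "('n \<Rightarrow> nat) \<Rightarrow> real" where "a \<alpha> = \<epsilon> * (NN 1 (mi_abs \<alpha>) / fact (mi_abs \<alpha>))" for \<alpha>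
    have a_pos: "a \<alpha> > 0" for \<alpha> using \<epsilon> Npos by (simp add: a_def)
    have "a \<in> step_ball NN 1 \<epsilon>"
      using \<epsilon> Npos[of 1] by (simp add: step_ball_def a_def abs_mult less_imp_neq[symmetric] less_imp_le)
    then have aW: "(\<lambda>\<alpha>. (b \<alpha> + a \<alpha>) - b \<alpha>) \<in> W" using \<epsilon> by auto
    have "(\<lambda>\<alpha>. b \<alpha> + a \<alpha>) \<in> Lambda_roumieu NN"
    proof -
      obtain l h C where lh: "l > 0" "h > 0"
        and C: "\<And>\<alpha>. \<bar>b \<alpha>\<bar> / (h ^ mi_abs \<alpha> * (NN l (mi_abs \<alpha>) / fact (mi_abs \<alpha>))) \<le> C"
        using b unfolding Lambda_roumieu_def seq_bounded_def by blast
      \<comment> \<open>\<open>b\<close> is bounded with parameters \<open>l\<close> and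
        \<open>h\<close>, \<open>a\<close> with 1 and 1; the maxima dominate both.\<close>
      have "\<bar>b \<alpha> + a \<alpha>\<bar> / (max h 1 ^ mi_abs \<alpha> * (NN (max l 1) (mi_abs \<alpha>) / fact (mi_abs \<alpha>))) \<le> \<bar>C\<bar> + \<epsilon>" for \<alpha>
      proof -
        let ?p = "mi_abs \<alpha>"
        have "\<bar>b \<alpha>\<bar> \<le> C * (h ^ ?p * (NN l ?p / fact ?p))"
          using C[of \<alpha>] lh Npos[of l ?p] by (simp add: field_simps)
        also have "\<dots> \<le> \<bar>C\<bar> * (h ^ ?p * (NN l ?p / fact ?p))"
          using lh Npos[of l ?p] by (intro mult_right_mono) auto
        also have "\<dots> = (\<bar>C\<bar> * h ^ ?p * NN l ?p) / fact ?p" by simp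
        also have "\<dots> \<le> (\<bar>C\<bar> * max h 1 ^ ?p * NN (max l 1) ?p) / fact ?p"
          using lh by (intro divide_right_mono weight_matrix_mono_bound[OF assms(3)]) auto
        finally have 1: "\<bar>b \<alpha>\<bar> \<le> (\<bar>C\<bar> * max h 1 ^ ?p * NN (max l 1) ?p) / fact ?p" .
        have "\<bar>a \<alpha>\<bar> = (\<epsilon> * 1 ^ ?p * NN 1 ?p) / fact ?p"
          using \<epsilon> Npos[of 1 ?p] by (simp add: a_def abs_mult)
        also have "\<dots> \<le> (\<epsilon> * max h 1 ^ ?p * NN (max l 1) ?p) / fact ?p"
          using \<epsilon> by (intro divide_right_mono weight_matrix_mono_bound[OF assms(3)]) auto
        finally have 2: "\<bar>a \<alpha>\<bar> \<le> (\<epsilon> * max h 1 ^ ?p * NN (max l 1) ?p) / fact ?p" .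
        have "\<bar>b \<alpha> + a \<alpha>\<bar> \<le> (\<bar>C\<bar> + \<epsilon>) * (max h 1 ^ ?p * (NN (max l 1) ?p / fact ?p))"
          using 1 2 abs_triangle_ineq[of "b \<alpha>" "a \<alpha>"]
          by (simp add: distrib_right add_divide_distrib mult_ac)
        moreover have "max h 1 ^ ?p * (NN (max l 1) ?p / fact ?p) > 0"
          using Npos[of "max l 1" ?p] by simp
        ultimately show ?thesis by (simp only: pos_divide_le_eq)
      qed
      then show ?thesis unfolding Lambda_roumieu_def seq_bounded_def
        by (intro CollectI exI[of _ "max l 1"] exI[of _ "max h 1"] exI[of _ "\<bar>C\<bar> + \<epsilon>"] conjI allI) auto
    qed
    moreover have "(\<lambda>\<alpha>. b \<alpha> + a \<alpha>) \<notin> jet_image MM"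
    proof
      assume "(\<lambda>\<alpha>. b \<alpha> + a \<alpha>) \<in> jet_image MM"
      \<comment> \<open>\<open>undefined\<close> stands for an arbitrary fixed coordinate
        direction.\<close>
      then have "\<exists>\<delta> A. \<delta> > 0 \<and> A > 0 \<and> (\<forall>j. a (\<lambda>m. if m = undefined then j else 0) * \<delta> ^ j \<le> A)"
        by (rule jet_image_difference_positive_bound[OF assms(1,2) True, of _ undefined])
           (use a_pos in auto)
      then obtain \<delta> A where \<delta>: "\<delta> > 0" "A > 0"
        and A: "\<And>j. a (\<lambda>m. if m = undefined then j else 0) * \<delta> ^ j \<le> A"
        by blast
      \<comment> \<open>\<open>B\<close> is at least 1, so
        \<open>A / \<epsilon> \<le> B \<le> B ^ k\<close> for every positive \<open>k\<close>: the
        roots of \<open>A / \<epsilon>\<close> are bounded by \<open>B\<close> uniformly in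
        \<open>k\<close>.\<close>
      define B where "B = max 1 (A / \<epsilon>)"
      obtain k where k: "k > 0" "root k (NN 1 k / fact k) > B / \<delta>"
        using assms(5) by (meson zero_less_one)
      have "\<epsilon> * (NN 1 k / fact k) * \<delta> ^ k \<le> A" using A[of k] by (simp add: a_def)
      then have "NN 1 k / fact k \<le> A / \<epsilon> / \<delta> ^ k"
        using \<epsilon> \<delta> by (simp add: field_simps)
      also have "\<dots> \<le> B ^ k / \<delta> ^ k"
      proof -
        have "A / \<epsilon> \<le> B" by (simp add: B_def)
        also have "B \<le> B ^ k" using k by (intro self_le_power) (auto simp: B_def)
        finally show ?thesis using \<delta> by (intro divide_right_mono) auto
      qed
      also have "\<dots> = (B / \<delta>) ^ k" by (simp add: power_divide)
      finally have "root k (NN 1 k / fact k) \<le> root k ((B / \<delta>) ^ k)"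
        using k by simp
      also have "\<dots> = B / \<delta>" using k \<delta> by (intro real_root_power_cancel) (auto simp: B_def)
      finally show False using k by simp
    qed
    ultimately show ?thesis using aW by (intro bexI[of _ "\<lambda>\<alpha>. b \<alpha> + a \<alpha>"]) auto
  qed
qed simp

end
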